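(* Let $E$ be the system of equations $$q_{i1}\alpha_i^{x_1}+\cdots+q_{ik}\alpha_i^{x_k}=0,\qquad i=1,\ldots,s,$$ in unknowns $x_1,\ldots,x_k\in\mathbb{Z}$, where $0\le t\le s$, $\alpha_1,\ldots,\alpha_t\in\overline{\mathbb{Q}}\setminus\{0\}$ are not roots of unity, $\alpha_{t+1},\ldots,\alpha_s\neq 1$ are roots of unity, $q_{ij}\in\mathbb{Z}[\alpha_i]$, and for every $j$ there is some $i$ with $q_{ij}\neq 0$. Then the set of all solutions of $E$ in $\mathbb{Z}^k$ is equal to $$\bigcup_{(\overline{x},\mathcal{J})\in\mathcal{T}(E)}S_{\overline{x},\mathcal{J}},$$ with the finite set $\mathcal{T}(E)$ and the sets $S_{\overline{x},\mathcal{J}}$ as defined in the context.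
   Context: $\overline{\mathbb{Q}}$ is an algebraic closure of $\mathbb{Q}$. Coefficients $q_{ij}$ are of the form $\sum_{h=0}^{d_i-1}r_{ij}^h\alpha_i^h$ with $r_{ij}^h\in\mathbb{Z}$, $d_i=\deg\alpha_i$. Let $n_i$ be the multiplicative order of $\alpha_i$ for $t<i\le s$. Put $N_E=1$ if $t=s$ and $N_E=\operatorname{lcm}(n_{t+1},\ldots,n_s)$ otherwise. $E_{\le t}$ denotes the subsystem of the first $t$ equations of $E$ (for $t=0$ this is the empty system, which every tuple solves). For a solution $\overline{x}\in\mathbb{Z}^k$ of $E_{\le t}$, a nonempty set $J\subseteq\{1,\ldots,k\}$ is a cluster (for $\overline{x}$ and $E_{\le t}$) if (C1) $\sum_{j\in J}q_{ij}\alpha_i^{x_j}=0$ for every $i=1,\ldots,t$, and (C2) no nonempty proper subset of $J$ satisfies (C1). A cluster structure for $\overline{x}$ and $E_{\le t}$ is a partition $\mathcal{J}=\{J_1,\ldots,J_m\}$ of $\{1,\ldots,k\}$ into clusters. For $J\subseteq\{1,\ldots,k\}$, $\Delta_J\in\{0,1\}^k$ is the indicator vector of $J$. The span of a cluster $J$ is $\operatorname{span}_J(\overline{x})=\max_{j\in J}x_j-\min_{j\in J}x_j$, and $\operatorname{maxspan}(E_{\le t})$ is the maximum of $\operatorname{span}_J(\overline{x})$ over all solutions $\overline{x}$ of $E_{\le t}$ and all clusters $J$ for $\overline{x}$ (this maximum is finite; it is $0$ if there are no solutions, and it is $0$ for $t=0$). For a solution $\overline{x}$ of $E$ and a cluster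 structure $\mathcal{J}=\{J_1,\ldots,J_m\}$ for $\overline{x}$ and $E_{\le t}$, $$S_{\overline{x},\mathcal{J}}=\{\overline{x}+N_E\beta_1\Delta_{J_1}+\cdots+N_E\beta_m\Delta_{J_m}\mid \beta_1,\ldots,\beta_m\in\mathbb{Z}\}\subseteq\mathbb{Z}^k.$$ $\mathcal{T}(E)$ is the set of all pairs $(\overline{x},\mathcal{J})$ such that $\overline{x}=(x_1,\ldots,x_k)\in\mathbb{Z}^k$ is a solution of $E$, $\mathcal{J}$ is a cluster structure for $\overline{x}$ and $E_{\le t}$, and $0\le x_1,\ldots,x_k<N_E+\operatorname{maxspan}(E_{\le t})$. *)

theory Defs
  imports "HOL-Analysis.Analysis" "HOL-Computational_Algebra.Polynomial"
    "HOL-Library.Disjoint_Sets"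
begin

text \<open>
  The field of algebraic numbers is taken to be the set of all algebraic complex numbers.
  The unknowns are indexed by a finite type \<open>'k\<close>, so a tuple of integers has type
  \<open>int ^ 'k\<close>; the equations are indexed by \<open>1, \<dots>, s\<close>.
\<close>

definition root_of_unity :: "complex \<Rightarrow> bool" where
  "root_of_unity a \<longleftrightarrow> (\<exists>n::nat. n > 0 \<and> a ^ n = 1)"

definition mult_order :: "complex \<Rightarrow> nat" where
  "mult_order a = (LEAST n. n > 0 \<and> a ^ n = 1)"

definition int_adjoin :: "complex \<Rightarrow> complex set" where
  "int_adjoin a = {poly (map_poly of_int p) a | p :: int poly. True}"

text \<open>
  A cluster condition or equation is stated for the first \<open>n\<close> equations, so that \<open>n = s\<close> is the
  full system and \<open>n = t\<close> the subsystem of equations whose base is not a root of unity.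
\<close>

definition vanishes_on ::
  "(nat \<Rightarrow> complex) \<Rightarrow> (nat \<Rightarrow> 'k::finite \<Rightarrow> complex) \<Rightarrow> nat \<Rightarrow> int ^ 'k \<Rightarrow> 'k set \<Rightarrow> bool" where
  "vanishes_on \<alpha> q n x J \<longleftrightarrow> (\<forall>i\<in>{1..n}. (\<Sum>j\<in>J. q i j * \<alpha> i powi (x $ j)) = 0)"

definition solutions ::
  "(nat \<Rightarrow> complex) \<Rightarrow> (nat \<Rightarrow> 'k::finite \<Rightarrow> complex) \<Rightarrow> nat \<Rightarrow> (int ^ 'k) set" where
  "solutions \<alpha> q n = {x. \<forall>i\<in>{1..n}. (\<Sum>j\<in>UNIV. q i j * \<alpha> i powi (x $ j)) = 0}"

definition is_cluster ::
  "(nat \<Rightarrow> complex) \<Rightarrow> (nat \<Rightarrow> 'k::finite \<Rightarrow> complex) \<Rightarrow> nat \<Rightarrow> int ^ 'k \<Rightarrow> 'k set \<Rightarrow> bool" where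
  "is_cluster \<alpha> q t x J \<longleftrightarrow> J \<noteq> {} \<and> vanishes_on \<alpha> q t x J \<and>
     (\<forall>I. I \<noteq> {} \<and> I \<subset> J \<longrightarrow> \<not> vanishes_on \<alpha> q t x I)"

definition cluster_structure ::
  "(nat \<Rightarrow> complex) \<Rightarrow> (nat \<Rightarrow> 'k::finite \<Rightarrow> complex) \<Rightarrow> nat \<Rightarrow> int ^ 'k \<Rightarrow> 'k set set \<Rightarrow> bool" where
  "cluster_structure \<alpha> q t x P \<longleftrightarrow> partition_on UNIV P \<and> (\<forall>J\<in>P. is_cluster \<alpha> q t x J)"

definition cluster_span :: "int ^ 'k::finite \<Rightarrow> 'k set \<Rightarrow> int" where
  "cluster_span x J = Max ((\<lambda>j. x $ j) ` J) - Min ((\<lambda>j. x $ j) ` J)"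

text \<open>
  Spans are nonnegative, so inserting \<open>0\<close> only provides the value when there are no solutions.
  \<open>Max\<close> is meaningful because the set of spans is finite for the systems considered.
\<close>

definition maxspan ::
  "(nat \<Rightarrow> complex) \<Rightarrow> (nat \<Rightarrow> 'k::finite \<Rightarrow> complex) \<Rightarrow> nat \<Rightarrow> int" where
  "maxspan \<alpha> q t = Max (insert 0
     {cluster_span x J | x J. x \<in> solutions \<alpha> q t \<and> is_cluster \<alpha> q t x J})"

definition N_E :: "(nat \<Rightarrow> complex) \<Rightarrow> nat \<Rightarrow> nat \<Rightarrow> nat" where
  "N_E \<alpha> t s = (if t = s then 1 else Lcm ((\<lambda>i. mult_order (\<alpha> i)) ` {t+1..s}))"

definition indicator_vec :: "'k::finite set \<Rightarrow> int ^ 'k" where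
  "indicator_vec J = (\<chi> j. if j \<in> J then 1 else 0)"

definition S_set ::
  "(nat \<Rightarrow> complex) \<Rightarrow> nat \<Rightarrow> nat \<Rightarrow> int ^ 'k::finite \<Rightarrow> 'k set set \<Rightarrow> (int ^ 'k) set" where
  "S_set \<alpha> t s x P =
     {x + (\<Sum>J\<in>P. (int (N_E \<alpha> t s) * \<beta> J) *s indicator_vec J) | \<beta> :: 'k set \<Rightarrow> int. True}"

definition T_set ::
  "(nat \<Rightarrow> complex) \<Rightarrow> (nat \<Rightarrow> 'k::finite \<Rightarrow> complex) \<Rightarrow> nat \<Rightarrow> nat \<Rightarrow> ((int ^ 'k) \<times> 'k set set) set" where
  "T_set \<alpha> q t s = {(x, P). x \<in> solutions \<alpha> q s \<and> cluster_structure \<alpha> q t x P \<and>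
     (\<forall>j. 0 \<le> x $ j \<and> x $ j < int (N_E \<alpha> t s) + maxspan \<alpha> q t)}"

end

theory Submission
  imports Defs "HOL-Computational_Algebra.Polynomial_Factorial"
    "HOL-Computational_Algebra.Fundamental_Theorem_Algebra"
begin

text \<open>
  The heart of the matter is that the spans of clusters are bounded. For a single equation with
  base \<open>a\<close>, let \<open>f\<close> be an irreducible integer polynomial with root \<open>a\<close>. If a fixed nonzero element
  of \<open>\<int>[a, 1/a]\<close> cannot be a sum of terms \<open>q\<^sub>j a\<^sup>n\<close> with all exponents \<open>n\<close> large, then the terms of
  smallest exponents in a minimal vanishing sum must be followed by another term at bounded
  distance, so the span is bounded. This property holds if \<open>a\<close> has a conjugate inside the unit
  disc (by absolute values), or if \<open>f(0)\<close> is not a unit (by a \<open>p\<close>-adic argument carried out with formal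
  power series); it holds for \<open>1/a\<close> if \<open>a\<close> has a conjugate outside the unit disc. In the remaining
  case \<open>a\<close> is a root of unity by Kronecker's theorem. For a system, every cluster splits for each
  equation into minimal vanishing sets of bounded span, hence a large gap in a cluster would split
  it for all equations simultaneously.

  Given this, clusters may be translated by multiples of \<open>N_E\<close> without leaving the solution set, and
  reducing the minimum of each cluster modulo \<open>N_E\<close> moves any solution into the finite box.
\<close>

section \<open>Integer polynomials at a complex number\<close>

text \<open>Polynomials stay over the integers, so that irreducibility and divisibility in Z[X] are
  available; \<open>int_adjoin a\<close> is the set of all values \<open>ieval p a\<close>.\<close>

definition ieval :: "int poly \<Rightarrow> complex \<Rightarrow> complex" where
  "ieval p a = poly (map_poly of_int p) a"

lemma ieval_0 [simp]: "ieval 0 a = 0"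
  by (simp add: ieval_def)

lemma ieval_pCons [simp]: "ieval (pCons c p) a = of_int c + a * ieval p a"
  by (cases "c = 0 \<and> p = 0") (auto simp: ieval_def map_poly_pCons)

lemma ieval_1 [simp]: "ieval 1 a = 1"
  by (simp add: one_pCons)

lemma ieval_add [simp]: "ieval (p + q) a = ieval p a + ieval q a"
proof -
  have "map_poly of_int (p + q) = map_poly of_int p + (map_poly of_int q :: complex poly)"
    by (rule poly_eqI) (simp add: coeff_map_poly)
  then show ?thesis by (simp add: ieval_def)
qed

lemma ieval_smult [simp]: "ieval (smult c p) a = of_int c * ieval p a"
  by (induction p) (auto simp: algebra_simps)

lemma ieval_minus [simp]: "ieval (- p) a = - ieval p a"
  using ieval_smult[of "-1" p a] by simp

lemma ieval_diff [simp]: "ieval (p - q) a = ieval p a - ieval q a"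
  using ieval_add[of p "- q" a] by simp

lemma ieval_mult [simp]: "ieval (p * q) a = ieval p a * ieval q a"
  by (induction p) (auto simp: algebra_simps)

lemma ieval_monom [simp]: "ieval (monom c n) a = of_int c * a ^ n"
  by (simp add: ieval_def map_poly_monom poly_monom)

lemma ieval_sum [simp]: "ieval (sum p I) a = (\<Sum>j\<in>I. ieval (p j) a)"
  by (induction I rule: infinite_finite_induct) auto

lemma ieval_dvd: "p dvd q \<Longrightarrow> ieval p a = 0 \<Longrightarrow> ieval q a = 0"
  by (auto elim!: dvdE)

lemma ieval_at_0: "ieval p 0 = of_int (coeff p 0)"
  by (induction p) auto

lemma ieval_reflect_poly:
  assumes "a \<noteq> 0"
  shows "ieval (reflect_poly p) (inverse a) * a ^ degree p = ieval p a"
proof -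
  have deg: "degree (map_poly of_int p :: complex poly) = degree p"
    by (simp add: degree_map_poly)
  have "map_poly of_int (reflect_poly p) = reflect_poly (map_poly of_int p :: complex poly)"
    by (rule poly_eqI) (simp add: coeff_map_poly coeff_reflect_poly deg)
  then show ?thesis
    using assms by (simp add: ieval_def poly_reflect_poly_nz deg field_simps)
qed

section \<open>Algebraic numbers as roots of irreducible integer polynomials\<close>

lemma algebraic_imp_ieval:
  assumes "algebraic a"
  obtains p where "p \<noteq> 0" "ieval p a = 0"
proof -
  obtain p where p: "\<And>i. coeff p i \<in> \<int>" "p \<noteq> 0" "poly p a = 0"
    using algebraicE[OF assms] by blast
  let ?r = "map_poly (inv of_int) p :: int poly"
  \<comment> \<open>\<open>map_poly\<close> acts coefficientwise only for a map that sends 0 to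
    0.\<close>
  have "inv of_int (0 :: complex) = (0 :: int)"
    using inv_f_f[of "of_int :: int \<Rightarrow> complex" 0] by (simp add: inj_def)
  then have r: "p = map_poly of_int ?r"
    using p(1) by (intro poly_eqI) (simp add: coeff_map_poly f_inv_into_f Ints_def)
  have "?r \<noteq> 0" using p(2) r by fastforce
  moreover have "ieval ?r a = 0" using p(3) r by (simp add: ieval_def)
  ultimately show ?thesis using that by blast
qed

text \<open>Z[X] is not a principal ideal domain, so pseudo-division replaces division: an element
  \<open>w\<close> of least degree in the ideal of \<open>f\<close> and \<open>g\<close> divides
  nonzero integer multiples of both, and primality of \<open>f\<close> then forces \<open>w\<close>
  to be constant.\<close>

lemma irreducible_int_poly_bezout:
  fixes f g :: "int poly"
  assumes f: "irreducible f" "degree f > 0" and g: "\<not> f dvd g"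
  obtains u v m where "m \<noteq> 0" "u * f + v * g = [:m:]"
proof -
  let ?I = "{u * f + v * g | u v. True}"
  have "f = 1 * f + 0 * g" by simp
  then have "f \<in> ?I" by blast
  moreover have "f \<noteq> 0" using f by auto
  ultimately have "f \<in> ?I - {0}" by blast
  from ex_has_least_nat[of "\<lambda>w. w \<in> ?I - {0}", OF this, of degree]
  obtain w where w: "w \<in> ?I" "w \<noteq> 0" and min: "\<forall>h. h \<in> ?I - {0} \<longrightarrow> degree w \<le> degree h"
    by blast
  obtain uw vw where uvw: "w = uw * f + vw * g" using w by blast
  \<comment> \<open>The pseudo-remainder of an ideal element by \<open>w\<close> is again in the
    ideal and is zero or of smaller degree, so it is zero.\<close>
  have dvd: "\<exists>c d. c \<noteq> 0 \<and> smult c h = w * d" if "h = u * f + v * g" for h u v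
  proof -
    obtain c d where cd: "c \<noteq> 0" "smult c h = w * d + pseudo_mod h w"
      using pseudo_mod(1)[OF w(2)] by blast
    have "pseudo_mod h w = (smult c u - d * uw) * f + (smult c v - d * vw) * g"
      using cd(2) unfolding uvw that by (simp add: algebra_simps smult_add_right)
    then have "pseudo_mod h w \<in> ?I" by blast
    then have "pseudo_mod h w = 0 \<or> degree w \<le> degree (pseudo_mod h w)"
      using min by blast
    then have "pseudo_mod h w = 0"
      using pseudo_mod(2)[OF w(2), of h] by auto
    then show ?thesis using cd by auto
  qed
  have prime: "prime_elem f" using f by (simp add: irreducible_imp_prime_elem)
  have not_dvd_const: "\<not> f dvd [:c:]" if "c \<noteq> 0" for c
    using that f(2) dvd_imp_degree_le[of f "[:c:]"] by auto
  obtain c d where cd: "c \<noteq> 0" "smult c f = w * d" using dvd[of f 1 0] by auto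
  obtain c' d' where cd': "c' \<noteq> 0" "smult c' g = w * d'" using dvd[of g 0 1] by auto
  have "f dvd w * d" unfolding cd(2)[symmetric] by (simp add: dvd_smult)
  then consider "f dvd w" | "f dvd d" using prime by (auto simp: prime_elem_dvd_mult_iff)
  then show ?thesis
  proof cases
    case 1
    then have "f dvd [:c':] * g" using cd' by (simp add: dvd_mult2)
    then have "f dvd [:c':]" using prime g prime_elem_dvd_mult_iff by blast
    then have False using not_dvd_const cd' by blast
    then show ?thesis ..
  next
    case 2
    \<comment> \<open>Cancelling \<open>f\<close> leaves \<open>w * e\<close> equal to a nonzero
      constant, so \<open>w\<close> has degree 0.\<close>
    then obtain e where "d = f * e" by blast
    then have "f * (w * e) = f * [:c:]" using cd by (simp add: algebra_simps)
    moreover have "f \<noteq> 0" using f by auto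
    ultimately have "w * e = [:c:]" by (metis mult_left_cancel)
    then have "degree (w * e) = 0" "w * e \<noteq> 0" using cd by auto
    then have "degree w = 0" by (auto simp: degree_mult_eq)
    then obtain m where "w = [:m:]" by (rule degree_eq_zeroE)
    then show ?thesis using that[of m uw vw] w uvw by auto
  qed
qed

text \<open>Otherwise the Bezout identity, evaluated at \<open>a\<close>, would make a nonzero
  integer vanish. Thus \<open>f\<close> plays the part of a minimal polynomial over Z.\<close>

lemma irreducible_dvd_of_common_root:
  assumes "irreducible f" "degree f > 0" "ieval f a = 0" "ieval g a = 0"
  shows "f dvd g"
proof (rule ccontr)
  assume "\<not> f dvd g"
  then obtain u v m where m: "m \<noteq> 0" "u * f + v * g = [:m:]"
    using irreducible_int_poly_bezout assms by metis
  have "ieval (u * f + v * g) a = 0" using assms by simp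
  then show False using m by simp
qed

text \<open>Z[X] is factorial, and a root of a product is a root of one of its prime
  factors.\<close>

lemma algebraic_imp_irreducible:
  assumes "algebraic a"
  obtains f where "irreducible f" "degree f > 0" "ieval f a = 0"
proof -
  obtain p where p: "p \<noteq> 0" "ieval p a = 0" using algebraic_imp_ieval assms .
  have "\<exists>f. irreducible f \<and> ieval f a = 0"
    using p
  proof (induction p rule: prime_divisors_induct)
    case (unit p)
    then have "ieval 1 a = 0" by (metis ieval_dvd)
    then show ?case by simp
  next
    case (factor p x)
    then show ?case by (auto intro: prime_elem_imp_irreducible)
  qed auto
  then obtain f where f: "irreducible f" "ieval f a = 0" by blast
  have "degree f > 0"
  proof (rule ccontr)
    assume "\<not> degree f > 0"
    then obtain c where "f = [:c:]" using degree_eq_zeroE by blast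
    then show False using f by auto
  qed
  then show ?thesis using f that by blast
qed

text \<open>A common root of \<open>f\<close> and its derivative would make \<open>f\<close> divide
  a nonzero polynomial of smaller degree.\<close>

lemma irreducible_int_poly_rsquarefree:
  assumes "irreducible f" "degree f > 0"
  shows "rsquarefree (map_poly of_int f :: complex poly)"
  unfolding rsquarefree_roots
proof (intro allI notI, elim conjE)
  fix b :: complex
  assume "poly (map_poly of_int f) b = 0" "poly (pderiv (map_poly of_int f)) b = 0"
  moreover have "pderiv (map_poly of_int f) = (map_poly of_int (pderiv f) :: complex poly)"
    by (rule poly_eqI) (simp add: coeff_pderiv coeff_map_poly)
  ultimately have "ieval f b = 0" "ieval (pderiv f) b = 0" by (simp_all add: ieval_def)
  then have "f dvd pderiv f" using irreducible_dvd_of_common_root assms by blast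
  moreover have "pderiv f \<noteq> 0" using assms by (simp add: pderiv_eq_0_iff)
  ultimately have "degree f \<le> degree (pderiv f)" by (rule dvd_imp_degree_le)
  then show False using assms by (simp add: degree_pderiv)
qed

text \<open>A non-unit constant dividing all coefficients would be a proper factor of
  \<open>f\<close>. The index \<open>r\<close> is the order of vanishing of \<open>f\<close> modulo
  \<open>p\<close> at 0.\<close>

lemma irreducible_int_poly_primitive:
  fixes f :: "int poly"
  assumes f: "irreducible f" "degree f > 0" and p: "\<not> is_unit p"
  obtains r where "\<not> p dvd coeff f r" "\<And>i. i < r \<Longrightarrow> p dvd coeff f i"
proof -
  have "\<not> [:p:] dvd f"
  proof
    assume "[:p:] dvd f"
    then obtain h where h: "f = [:p:] * h" by blast
    then have "is_unit h" using irreducibleD[OF f(1) h] p by (auto simp: is_unit_const_poly_iff)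
    then have "degree h = 0" by (auto simp: is_unit_poly_iff)
    then show False using f(2) h by (cases "p = 0") auto
  qed
  then have ex: "\<exists>r. \<not> p dvd coeff f r" by (simp add: const_poly_dvd_iff)
  show ?thesis
    using LeastI_ex[OF ex] not_less_Least[of _ "\<lambda>r. \<not> p dvd coeff f r"] that by blast
qed

text \<open>
  A nonzero integer \<open>m\<close> cannot be a multiple of \<open>f\<close> among the formal power series over the
  integers: modulo a prime divisor \<open>p\<close> of the constant term the quotient would vanish
  if \<open>p dvd m\<close>, so all factors \<open>p\<close> of \<open>m\<close> can be cancelled.
\<close>
lemma not_const_dvd_mod_monom:
  fixes f :: "int poly"
  assumes f: "irreducible f" "degree f > 0" and p: "prime p" "p dvd coeff f 0"
    and m: "\<And>n. \<exists>u. monom 1 n dvd [:m:] - f * u"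
  shows "m = 0"
  using m
proof (induction "nat \<bar>m\<bar>" arbitrary: m rule: less_induct)
  case less
  have "\<not> is_unit p" using p by auto
  then obtain r where r: "\<not> p dvd coeff f r" "\<And>i. i < r \<Longrightarrow> p dvd coeff f i"
    using irreducible_int_poly_primitive f by blast
  \<comment> \<open>Comparing constant terms already shows that \<open>p\<close> divides
    \<open>m\<close>.\<close>
  obtain u where "monom 1 1 dvd [:m:] - f * u" using less.prems by blast
  then have "coeff ([:m:] - f * u) 0 = 0" by (simp add: monom_1_dvd_iff')
  then have "m = coeff f 0 * coeff u 0" by (simp add: coeff_mult)
  then have "p dvd m" using p by simp
  then obtain m' where m': "m = p * m'" by blast
  show ?case
  proof (rule ccontr)
    assume "m \<noteq> 0"
    have "m' = 0"
    proof (rule less.hyps)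
      have "\<bar>m'\<bar> * 1 < \<bar>m'\<bar> * p"
        using p \<open>m \<noteq> 0\<close> m' by (intro mult_strict_left_mono) (auto dest: prime_gt_1_int)
      then show "nat \<bar>m'\<bar> < nat \<bar>m\<bar>"
        using m' p by (simp add: abs_mult prime_ge_0_int mult.commute)
    next
      fix n
      \<comment> \<open>Modulo \<open>p\<close> the series \<open>f\<close> begins at degree
        \<open>r\<close>, so dividing by it loses \<open>r\<close> orders of precision.\<close>
      obtain u where u: "monom 1 (n + r) dvd [:m:] - f * u" using less.prems by blast
      have low: "p dvd coeff u i" if "i < n" for i
        using that
      proof (induction i rule: less_induct)
        case (less i)
        have "coeff ([:m:] - f * u) (i + r) = 0"
          using u less.prems by (simp add: monom_1_dvd_iff')
        then have "coeff (f * u) (i + r) = coeff [:m:] (i + r)" by simp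
        then have "p dvd coeff (f * u) (i + r)"
          using \<open>p dvd m\<close> by (auto simp: coeff_pCons split: nat.split)
        then have "p dvd (\<Sum>k\<le>i + r. coeff f k * coeff u (i + r - k))"
          by (simp add: coeff_mult)
        \<comment> \<open>Terms with \<open>k < r\<close> are divisible by \<open>p\<close> through
          \<open>f\<close>, those with \<open>k > r\<close> through the induction hypothesis on
          \<open>u\<close>; only the term \<open>k = r\<close> remains.\<close>
        also have "(\<Sum>k\<le>i + r. coeff f k * coeff u (i + r - k)) =
            coeff f r * coeff u i + (\<Sum>k\<in>{..i + r} - {r}. coeff f k * coeff u (i + r - k))"
          by (subst sum.remove[of _ r]) auto
        finally have "p dvd coeff f r * coeff u i +
            (\<Sum>k\<in>{..i + r} - {r}. coeff f k * coeff u (i + r - k))" .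
        moreover have "p dvd (\<Sum>k\<in>{..i + r} - {r}. coeff f k * coeff u (i + r - k))"
        proof (rule dvd_sum)
          fix k assume k: "k \<in> {..i + r} - {r}"
          show "p dvd coeff f k * coeff u (i + r - k)"
          proof (cases "k < r")
            case True
            then show ?thesis using r by simp
          next
            case False
            then have "i + r - k < i" using k by auto
            then show ?thesis using less by simp
          qed
        qed
        ultimately have "p dvd coeff f r * coeff u i" by (simp add: dvd_add_left_iff)
        then show ?case using r p by (simp add: prime_dvd_mult_iff)
      qed
      \<comment> \<open>The quotient of \<open>u\<close> by \<open>p\<close> up to degree
        \<open>n\<close>, which serves as the witness for \<open>m'\<close>.\<close>
      define u' where "u' = (\<Sum>i<n. monom (coeff u i div p) i)"
      have u': "p * coeff u' i = coeff u i" if "i < n" for i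
        using that low by (simp add: u'_def coeff_sum)
      have "monom 1 n dvd u - smult p u'"
        by (simp add: monom_1_dvd_iff' u')
      moreover have "monom 1 n dvd [:m:] - f * u"
        using u by (simp add: monom_1_dvd_iff')
      ultimately have "monom 1 n dvd ([:m:] - f * u) + f * (u - smult p u')"
        by (intro dvd_add dvd_mult)
      also have "\<dots> = smult p ([:m':] - f * u')"
        by (simp add: m' algebra_simps smult_diff_right)
      finally have "monom 1 n dvd [:m':] - f * u'"
        using p by (simp add: monom_1_dvd_iff' coeff_diff)
      then show "\<exists>u. monom 1 n dvd [:m':] - f * u" by blast
    qed
    then show False using m' \<open>m \<noteq> 0\<close> by simp
  qed
qed

lemma irreducible_coeff_0:
  assumes "irreducible f" "ieval f a = 0" "a \<noteq> 0"
  shows "coeff f 0 \<noteq> 0"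
proof
  assume "coeff f 0 = 0"
  then obtain h where h: "f = [:0, 1:] * h" by (cases f) auto
  have "\<not> is_unit ([:0, 1:] :: int poly)" by (simp add: is_unit_poly_iff)
  then have "is_unit h" using irreducibleD[OF assms(1) h] by blast
  moreover have "ieval h a = 0" using assms h by simp
  ultimately have "ieval 1 a = 0" using ieval_dvd by blast
  then show False by simp
qed

text \<open>If \<open>g\<close> were congruent to X^n times some \<open>h\<close> modulo
  \<open>f\<close> for every \<open>n\<close>, multiplying by the Bezout factor \<open>v\<close>
  would make the nonzero integer \<open>m\<close> congruent to a multiple of X^n modulo
  \<open>f\<close> for every \<open>n\<close>.\<close>

lemma not_highly_divisible:
  fixes f :: "int poly"
  assumes f: "irreducible f" "degree f > 0" "ieval f a = 0" and "\<not> is_unit (coeff f 0)"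
    and "a \<noteq> 0" and g: "ieval g a \<noteq> 0"
  obtains n where "\<And>h. ieval g a \<noteq> a ^ n * ieval h a"
proof (rule ccontr)
  assume "\<not> thesis"
  then have ex: "\<exists>h. ieval g a = a ^ n * ieval h a" for n using that by blast
  have "coeff f 0 \<noteq> 0" using irreducible_coeff_0 assms by blast
  then obtain p where p: "prime p" "p dvd coeff f 0"
    using assms prime_divisor_exists by blast
  have "\<not> f dvd g" using g f ieval_dvd by blast
  then obtain u v m where uvm: "m \<noteq> 0" "u * f + v * g = [:m:]"
    using irreducible_int_poly_bezout f by metis
  have "m = 0"
  proof (rule not_const_dvd_mod_monom[OF f(1,2) p])
    fix n
    obtain h where "ieval g a = a ^ n * ieval h a" using ex by blast
    then have "ieval (g - monom 1 n * h) a = 0" by simp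
    then have "f dvd g - monom 1 n * h" using irreducible_dvd_of_common_root f by blast
    then obtain e where e: "g - monom 1 n * h = f * e" by blast
    have "[:m:] - f * (u + v * e) = monom 1 n * (v * h)"
      unfolding uvm(2)[symmetric] distrib_left mult.left_commute[of f v] e[symmetric]
      by (simp add: algebra_simps)
    then show "\<exists>u. monom 1 n dvd [:m:] - f * u" by (metis dvd_triv_left)
  qed
  then show False using uvm by simp
qed

section \<open>Kronecker's theorem\<close>

lemma finite_bounded_int_polys:
  "finite {p :: int poly. degree p < d \<and> (\<forall>i. \<bar>coeff p i\<bar> \<le> B)}"
proof (rule finite_subset)
  show "finite (Poly ` {xs. set xs \<subseteq> {- B..B} \<and> length xs \<le> d})"
    by (intro finite_imageI finite_lists_length_le) auto
  show "{p :: int poly. degree p < d \<and> (\<forall>i. \<bar>coeff p i\<bar> \<le> B)} \<subseteq>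
      Poly ` {xs. set xs \<subseteq> {- B..B} \<and> length xs \<le> d}"
  proof
    fix p :: "int poly"
    assume p: "p \<in> {p. degree p < d \<and> (\<forall>i. \<bar>coeff p i\<bar> \<le> B)}"
    have "length (coeffs p) \<le> d"
      using p by (cases "p = 0") (auto simp: length_coeffs_degree)
    moreover have "set (coeffs p) \<subseteq> {- B..B}"
      using p by (auto simp: coeffs_def abs_le_iff minus_le_iff split: if_splits)
    ultimately show "p \<in> Poly ` {xs. set xs \<subseteq> {- B..B} \<and> length xs \<le> d}"
      by (intro image_eqI[of _ _ "coeffs p"]) auto
  qed
qed

text \<open>The second hypothesis says that the leading coefficient is 1 or -1, hence its own
  inverse, so division by \<open>f\<close> stays over the integers.\<close>

lemma monic_power_reduction:
  fixes f :: "int poly"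
  assumes "degree f > 0" "lead_coeff f * lead_coeff f = 1"
  shows "\<exists>r. degree r < degree f \<and> f dvd monom 1 n - r"
proof (induction n)
  case 0
  show ?case using assms by (intro exI[of _ 1]) (simp add: one_pCons monom_0)
next
  case (Suc n)
  then obtain r where r: "degree r < degree f" "f dvd monom 1 n - r" by blast
  \<comment> \<open>Chosen so that subtracting \<open>smult c f\<close> cancels the coefficient of X
    times \<open>r\<close> in degree \<open>degree f\<close>.\<close>
  define c where "c = coeff r (degree f - 1) * lead_coeff f"
  have "f dvd [:0, 1:] * (monom 1 n - r) + smult c f"
    using r by (intro dvd_add dvd_mult dvd_smult) auto
  also have "\<dots> = monom 1 (Suc n) - (pCons 0 r - smult c f)"
    by (simp add: monom_Suc)
  finally have "f dvd monom 1 (Suc n) - (pCons 0 r - smult c f)" .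
  moreover have "degree (pCons 0 r - smult c f) < degree f"
  proof (rule degree_lessI)
    show "\<forall>k\<ge>degree f. coeff (pCons 0 r - smult c f) k = 0"
    proof (intro allI impI)
      fix k assume k: "degree f \<le> k"
      then obtain k' where k': "k = Suc k'" using assms by (cases k) auto
      show "coeff (pCons 0 r - smult c f) k = 0"
      proof (cases "k = degree f")
        case True
        then have "coeff (pCons 0 r - smult c f) k = coeff r k' * (1 - lead_coeff f * lead_coeff f)"
          using k' by (simp add: c_def flip: True) (simp add: algebra_simps)
        then show ?thesis using assms by simp
      next
        case False
        then show ?thesis using k k' r by (simp add: coeff_eq_0)
      qed
    qed
  qed (use assms in auto)
  ultimately show ?case by blast
qed

text \<open>
  The remainders of the powers of the variable modulo \<open>f\<close> have bounded coefficients, by Lagrange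
  interpolation at the roots of \<open>f\<close>; hence two of them coincide.
\<close>
lemma kronecker_root_of_unity:
  assumes f: "irreducible f" "degree f > 0" "ieval f a = 0" "is_unit (coeff f 0)"
    and unit: "\<And>b. ieval f b = 0 \<Longrightarrow> norm b = 1"
  shows "root_of_unity a"
proof -
  define F where "F = (map_poly of_int f :: complex poly)"
  define R where "R = {z. poly F z = 0}"
  have F: "F \<noteq> 0" "degree F = degree f" "lead_coeff F = of_int (lead_coeff f)"
    using f by (auto simp: F_def degree_map_poly coeff_map_poly map_poly_eq_0_iff)
  have R: "finite R" "\<And>b. b \<in> R \<longleftrightarrow> ieval f b = 0"
    using F by (auto simp: R_def poly_roots_finite F_def ieval_def)
  have dec: "smult (lead_coeff F) (\<Prod>z\<in>R. [:- z, 1:]) = F"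
    unfolding R_def
    by (rule complex_poly_decompose_rsquarefree)
      (use irreducible_int_poly_rsquarefree f in \<open>simp add: F_def\<close>)
  have "degree (smult (lead_coeff F) (\<Prod>z\<in>R. [:- z, 1:])) = degree (\<Prod>z\<in>R. [:- z, 1:])"
    using F(1) by simp
  also have "\<dots> = (\<Sum>z\<in>R. degree [:- z, 1:])" by (rule degree_prod_eq_sum_degree) simp
  also have "\<dots> = card R" by simp
  finally have card: "card R = degree f" unfolding dec using F(2) by simp
  \<comment> \<open>Evaluation at 0 expresses |f(0)| as the norm of the leading coefficient times
    the norms of the roots. Since |f(0)| and these norms are 1, the leading coefficient is 1 or
    -1.\<close>
  have "norm (poly (smult (lead_coeff F) (\<Prod>z\<in>R. [:- z, 1:])) 0) =
      norm (lead_coeff F) * (\<Prod>z\<in>R. norm z)"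
    by (simp add: poly_prod norm_mult flip: prod_norm)
  also have "(\<Prod>z\<in>R. norm z) = 1" using unit R by (intro prod.neutral) auto
  finally have "norm (poly F 0) = norm (lead_coeff F)" unfolding dec by simp
  moreover have "norm (poly F 0) = 1"
    using f(4) ieval_at_0[of f] by (simp add: F_def ieval_def)
  ultimately have "\<bar>real_of_int (lead_coeff f)\<bar> = 1" unfolding F(3) by (simp del: of_int_abs)
  then have "\<bar>lead_coeff f\<bar> = 1" by linarith
  then have "lead_coeff f * lead_coeff f = 1" by (metis abs_mult_self_eq mult_1)
  then obtain r where r: "\<And>n. degree (r n) < degree f" "\<And>n. f dvd monom 1 n - r n"
    using monic_power_reduction f by metis
  have ieval_r: "ieval (r n) b = b ^ n" if "b \<in> R" for n b
    using ieval_dvd[OF r(2)[of n]] that R by simp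
  \<comment> \<open>Lagrange basis polynomials for the roots of \<open>f\<close>, which are
    distinct.\<close>
  define L where "L b = smult (1 / (\<Prod>c\<in>R - {b}. b - c)) (\<Prod>c\<in>R - {b}. [:- c, 1:])" for b
  have deg_L: "degree (L b) < card R" if "b \<in> R" for b
  proof -
    have "degree (L b) \<le> card (R - {b})"
      unfolding L_def by (rule order_trans[OF degree_smult_le]) (subst degree_prod_eq_sum_degree, auto)
    also have "\<dots> < card R" using R(1) that by (rule card_Diff1_less)
    finally show ?thesis .
  qed
  have poly_L: "poly (L b) c = (if b = c then 1 else 0)" if "b \<in> R" "c \<in> R" for b c
    using that R(1) by (auto simp: L_def poly_prod)
  have interp: "map_poly of_int (r n) = (\<Sum>b\<in>R. smult (b ^ n) (L b))" for n
  proof (rule poly_eqI_degree)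
    fix c assume c: "c \<in> R"
    have "poly (\<Sum>b\<in>R. smult (b ^ n) (L b)) c = (\<Sum>b\<in>R. if b = c then b ^ n else 0)"
      unfolding poly_sum using c by (intro sum.cong) (auto simp: poly_L)
    also have "\<dots> = c ^ n" using c R by simp
    finally show "poly (map_poly of_int (r n)) c = poly (\<Sum>b\<in>R. smult (b ^ n) (L b)) c"
      using ieval_r c by (simp add: ieval_def)
  next
    show "degree (map_poly of_int (r n) :: complex poly) < card R"
      using r(1)[of n] card by (simp add: degree_map_poly)
  next
    show "degree (\<Sum>b\<in>R. smult (b ^ n) (L b)) < card R"
      using deg_L card f by (intro degree_sum_less) (auto intro: le_less_trans[OF degree_smult_le])
  qed
  \<comment> \<open>All roots have norm 1, so this bound on the coefficients of \<open>r n\<close>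
    does not depend on \<open>n\<close>.\<close>
  define B where "B = (\<Sum>i<degree f. \<Sum>b\<in>R. norm (coeff (L b) i))"
  have "\<bar>coeff (r n) i\<bar> \<le> \<lceil>B\<rceil>" for n i
  proof (cases "i < degree f")
    case True
    have "real_of_int \<bar>coeff (r n) i\<bar> = norm (coeff (map_poly of_int (r n) :: complex poly) i)"
      by (simp add: coeff_map_poly)
    also have "\<dots> \<le> (\<Sum>b\<in>R. norm (b ^ n * coeff (L b) i))"
      unfolding interp by (simp add: coeff_sum sum_norm_le)
    also have "\<dots> = (\<Sum>b\<in>R. norm (coeff (L b) i))"
      using unit R by (intro sum.cong) (auto simp: norm_mult norm_power)
    also have "\<dots> \<le> B"
      unfolding B_def using True by (intro member_le_sum) (auto intro: sum_nonneg)
    finally show ?thesis by linarith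
  next
    case False
    have "0 \<le> B" unfolding B_def by (intro sum_nonneg) auto
    then show ?thesis using False r(1)[of n] by (simp add: coeff_eq_0)
  qed
  then have "range r \<subseteq> {p. degree p < degree f \<and> (\<forall>i. \<bar>coeff p i\<bar> \<le> \<lceil>B\<rceil>)}"
    using r(1) by blast
  then have "finite (range r)" using finite_bounded_int_polys finite_subset by blast
  then have "\<not> inj r" using finite_imageD infinite_UNIV_nat by blast
  then obtain n m where nm: "r n = r m" "n < m"
    by (metis injI linorder_neqE_nat)
  have "a ^ n = a ^ m" using ieval_r[of a] nm R f by metis
  moreover have "a \<noteq> 0" using unit f by fastforce
  ultimately have "a ^ (m - n) = 1" using nm by (simp add: power_diff)
  then show ?thesis using nm unfolding root_of_unity_def by (metis zero_less_diff)
qed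

section \<open>Laurent polynomials with large exponents\<close>

text \<open>The ring Z[a, 1/a], with a single power of \<open>a\<close> factored out. Unlike Z[a],
  it does not change when \<open>a\<close> is replaced by its inverse.\<close>

definition laurent :: "complex \<Rightarrow> complex set" where
  "laurent a = {ieval p a * a powi m | p m. True}"

lemma laurent_power_int_mult:
  assumes "a \<noteq> 0" "c \<in> laurent a"
  shows "c * a powi m \<in> laurent a"
proof -
  obtain p n where "c = ieval p a * a powi n" using assms by (auto simp: laurent_def)
  then have "c * a powi m = ieval p a * a powi (n + m)" using assms by (simp add: power_int_add)
  then show ?thesis unfolding laurent_def by blast
qed

lemma laurent_uminus:
  assumes "c \<in> laurent a"
  shows "- c \<in> laurent a"
proof -
  obtain p n where "c = ieval p a * a powi n" using assms by (auto simp: laurent_def)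
  then have "- c = ieval (- p) a * a powi n" by simp
  then show ?thesis unfolding laurent_def by blast
qed

text \<open>The smaller of the two exponents serves as a common factor, and the excess is absorbed
  into the polynomials.\<close>

lemma laurent_add:
  assumes a: "a \<noteq> 0" and "c \<in> laurent a" "d \<in> laurent a"
  shows "c + d \<in> laurent a"
proof -
  obtain p q m n where c: "c = ieval p a * a powi m" and d: "d = ieval q a * a powi n"
    using assms by (auto simp: laurent_def)
  have *: "ieval r a * a powi k = ieval (r * monom 1 (nat (k - min m n))) a * a powi min m n"
    if "k \<ge> min m n" for r k
  proof -
    have "k = int (nat (k - min m n)) + min m n" using that by simp
    then have "a powi k = a ^ nat (k - min m n) * a powi min m n"
      using a power_int_add power_int_of_nat by metis
    then show ?thesis by (simp only: ieval_mult ieval_monom of_int_1 mult_1 mult.assoc)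
  qed
  have "c + d = ieval (p * monom 1 (nat (m - min m n)) + q * monom 1 (nat (n - min m n))) a
      * a powi min m n"
    unfolding c d ieval_add distrib_right by (intro arg_cong2[of _ _ _ _ "(+)"] *) auto
  then show ?thesis unfolding laurent_def by blast
qed

lemma laurent_0: "0 \<in> laurent a"
proof -
  have "0 = ieval 0 a * a powi 0" by simp
  then show ?thesis unfolding laurent_def by blast
qed

lemma laurent_sum:
  assumes "a \<noteq> 0" "\<And>j. j \<in> I \<Longrightarrow> c j \<in> laurent a"
  shows "sum c I \<in> laurent a"
  using assms(2)
proof (induction I rule: infinite_finite_induct)
  case (insert j I)
  then show ?case using laurent_add[OF assms(1), of "c j" "sum c I"] by simp
qed (simp_all add: laurent_0)

text \<open>Reversing the coefficients turns a polynomial in \<open>a\<close> into one in the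
  inverse, up to a power of \<open>a\<close>.\<close>

lemma laurent_inverse_subset:
  assumes "a \<noteq> 0"
  shows "laurent a \<subseteq> laurent (inverse a)"
proof
  fix c assume "c \<in> laurent a"
  then obtain p m where "c = ieval p a * a powi m" by (auto simp: laurent_def)
  then have "c = ieval (reflect_poly p) (inverse a) * (a powi int (degree p) * a powi m)"
    using ieval_reflect_poly[OF assms, of p] by simp
  then have "c = ieval (reflect_poly p) (inverse a) * inverse a powi (- (int (degree p) + m))"
    unfolding power_int_inverse power_int_minus inverse_inverse_eq
    using assms by (simp add: power_int_add)
  then show "c \<in> laurent (inverse a)" by (auto simp: laurent_def)
qed

lemma laurent_inverse: "a \<noteq> 0 \<Longrightarrow> laurent (inverse a) = laurent a"
  using laurent_inverse_subset[of a] laurent_inverse_subset[of "inverse a"] by (simp add: equalityI)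

text \<open>The threshold \<open>N\<close> may depend on the target \<open>c\<close> but not on the
  index set or the exponents; for finitely many targets a common threshold results.\<close>

definition tail_avoiding :: "complex \<Rightarrow> ('k::finite \<Rightarrow> complex) \<Rightarrow> bool" where
  "tail_avoiding a q \<longleftrightarrow> (\<forall>c\<in>laurent a - {0}. \<exists>N. \<forall>I x. (\<forall>j\<in>I. N \<le> x j) \<longrightarrow>
     (\<Sum>j\<in>I. q j * a powi x j) \<noteq> c)"

text \<open>A sum with large exponents contains a high power of \<open>a\<close> as a factor over
  Z[a], whereas a fixed nonzero target does not.\<close>

lemma tail_avoiding_if_nonunit:
  fixes q :: "'k::finite \<Rightarrow> complex"
  assumes f: "irreducible f" "degree f > 0" "ieval f a = 0" "\<not> is_unit (coeff f 0)"
    and a: "a \<noteq> 0" and q: "\<And>j. q j \<in> laurent a"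
  shows "tail_avoiding a q"
  unfolding tail_avoiding_def
proof
  fix c assume "c \<in> laurent a - {0}"
  then obtain g l where c: "c = ieval g a * a powi l" "ieval g a \<noteq> 0"
    by (auto simp: laurent_def)
  obtain n where n: "\<And>h. ieval g a \<noteq> a ^ n * ieval h a"
    using not_highly_divisible[OF f a c(2)] by blast
  have "\<forall>j. \<exists>p m. q j = ieval p a * a powi m" using q by (auto simp: laurent_def)
  then obtain p e where pe: "\<And>j. q j = ieval (p j) a * a powi e j" by metis
  define M where "M = (\<Sum>j\<in>UNIV. \<bar>e j\<bar>)"
  have M: "- M \<le> e j" for j
    using member_le_sum[of j UNIV "\<lambda>j. \<bar>e j\<bar>"] by (simp add: M_def)
  show "\<exists>N. \<forall>I x. (\<forall>j\<in>I. N \<le> x j) \<longrightarrow> (\<Sum>j\<in>I. q j * a powi x j) \<noteq> c"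
  \<comment> \<open>\<open>M\<close> makes up for negative exponents in the coefficients,
    \<open>l\<close> removes the power of \<open>a\<close> in \<open>c\<close>, and \<open>n\<close>
    is the power that does not divide \<open>ieval g a\<close>.\<close>
  proof (intro exI[of _ "int n + M + l"] allI impI notI)
    fix I :: "'k set" and x :: "'k \<Rightarrow> int"
    assume x: "\<forall>j\<in>I. int n + M + l \<le> x j" and eq: "(\<Sum>j\<in>I. q j * a powi x j) = c"
    define h where "h = (\<Sum>j\<in>I. p j * monom 1 (nat (x j + e j - l - int n)))"
    have "q j * a powi x j = a powi l * a ^ n * ieval (p j * monom 1 (nat (x j + e j - l - int n))) a"
      if "j \<in> I" for j
    proof -
      have "x j + e j = l + int n + int (nat (x j + e j - l - int n))"
        using x that M[of j] by force
      then have "a powi e j * a powi x j = a powi l * a ^ n * a ^ nat (x j + e j - l - int n)"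
        using a by (metis power_int_add power_int_of_nat add.commute)
      then show ?thesis by (simp add: pe)
    qed
    then have "c = a powi l * a ^ n * ieval h a"
      unfolding eq[symmetric] h_def by (simp add: sum_distrib_left)
    then have "ieval g a = a ^ n * ieval h a" using c a by simp
    then show False using n by blast
  qed
qed

text \<open>Multiplying by a power \<open>K\<close> that clears all negative exponents turns the
  relation into an integer polynomial vanishing at \<open>a\<close>, hence at
  \<open>b\<close>.\<close>

lemma conjugate_transfer:
  fixes a b :: complex
  assumes "finite I" "a \<noteq> 0" "b \<noteq> 0" and ab: "\<And>g. ieval g a = 0 \<Longrightarrow> ieval g b = 0"
    and eq: "(\<Sum>j\<in>I. ieval (p j) a * a powi e j) = ieval g a * a powi l"
  shows "(\<Sum>j\<in>I. ieval (p j) b * b powi e j) = ieval g b * b powi l"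
proof -
  define K where "K = \<bar>l\<bar> + (\<Sum>j\<in>I. \<bar>e j\<bar>)"
  have K: "0 \<le> e j + K" if "j \<in> I" for j
    using member_le_sum[of j I "\<lambda>j. \<bar>e j\<bar>"] that \<open>finite I\<close> by (simp add: K_def)
  have Kl: "0 \<le> l + K" by (auto simp: K_def intro: sum_nonneg add_increasing2 simp flip: add.assoc)
  define h where "h = (\<Sum>j\<in>I. p j * monom 1 (nat (e j + K))) - g * monom 1 (nat (l + K))"
  have h: "ieval h c = ((\<Sum>j\<in>I. ieval (p j) c * c powi e j) - ieval g c * c powi l) * c powi K"
    if "c \<noteq> 0" for c
  proof -
    have 1: "ieval (p j * monom 1 (nat (e j + K))) c = ieval (p j) c * c powi e j * c powi K" if "j \<in> I" for j
      using K[OF that] \<open>c \<noteq> 0\<close> by (simp add: power_int_def[of _ "e j + K"] flip: power_int_add)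
    have 2: "ieval (g * monom 1 (nat (l + K))) c = ieval g c * c powi l * c powi K"
      using Kl \<open>c \<noteq> 0\<close> by (simp add: power_int_def[of _ "l + K"] flip: power_int_add)
    show ?thesis
      by (simp only: h_def ieval_diff ieval_sum left_diff_distrib sum_distrib_right 1 2 cong: sum.cong)
  qed
  have "ieval h b = 0" using ab h[of a] eq assms by simp
  then show ?thesis using h[of b] assms by simp
qed

text \<open>At the conjugate \<open>b\<close> the tail tends to 0 as its exponents grow, while the
  conjugate of the target keeps its positive norm \<open>d\<close>.\<close>

lemma tail_avoiding_if_small_conjugate:
  fixes q :: "'k::finite \<Rightarrow> complex"
  assumes a: "a \<noteq> 0" and b: "b \<noteq> 0" "norm b < 1"
    and ab: "\<And>g. ieval g a = 0 \<longleftrightarrow> ieval g b = 0" and q: "\<And>j. q j \<in> laurent a"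
  shows "tail_avoiding a q"
  unfolding tail_avoiding_def
proof
  fix c assume "c \<in> laurent a - {0}"
  then obtain g l where c: "c = ieval g a * a powi l" "ieval g a \<noteq> 0"
    by (auto simp: laurent_def)
  have "\<forall>j. \<exists>p m. q j = ieval p a * a powi m" using q by (auto simp: laurent_def)
  then obtain p e where pe: "\<And>j. q j = ieval (p j) a * a powi e j" by metis
  define B where "B = (\<Sum>j\<in>UNIV. norm (ieval (p j) b * b powi e j))"
  define d where "d = norm (ieval g b * b powi l)"
  have "d > 0" using c(2) ab b by (simp add: d_def)
  have "B \<ge> 0" unfolding B_def by (intro sum_nonneg) auto
  \<comment> \<open>The denominator \<open>B + 1\<close> stays positive even if all coefficients
    vanish.\<close>
  obtain n where "norm b ^ n < d / (B + 1)"
    using real_arch_pow_inv[of "d / (B + 1)" "norm b"] b \<open>d > 0\<close> \<open>B \<ge> 0\<close> by auto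
  then have "(B + 1) * norm b ^ n < d"
    using \<open>B \<ge> 0\<close> by (simp add: field_simps)
  then have n: "B * norm b ^ n < d"
    using zero_le_power[OF norm_ge_zero, of b n] unfolding distrib_right mult_1 by linarith
  show "\<exists>N. \<forall>I x. (\<forall>j\<in>I. N \<le> x j) \<longrightarrow> (\<Sum>j\<in>I. q j * a powi x j) \<noteq> c"
  proof (intro exI[of _ "int n"] allI impI notI)
    fix I :: "'k set" and x :: "'k \<Rightarrow> int"
    assume x: "\<forall>j\<in>I. int n \<le> x j" and eq: "(\<Sum>j\<in>I. q j * a powi x j) = c"
    have "(\<Sum>j\<in>I. ieval (p j) a * a powi (e j + x j)) = ieval g a * a powi l"
      using eq a by (simp add: pe c power_int_add mult.assoc)
    then have "(\<Sum>j\<in>I. ieval (p j) b * b powi (e j + x j)) = ieval g b * b powi l"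
      by (rule conjugate_transfer[rotated 4]) (use a b ab in auto)
    then have "d = norm (\<Sum>j\<in>I. ieval (p j) b * b powi e j * b powi x j)"
      using b by (simp add: d_def power_int_add mult.assoc)
    also have "\<dots> \<le> (\<Sum>j\<in>I. norm (ieval (p j) b * b powi e j) * norm b ^ n)"
    proof (rule sum_norm_le)
      fix j assume "j \<in> I"
      then have "norm b powi x j \<le> norm b powi int n"
        using x b by (intro power_int_decreasing) auto
      then show "norm (ieval (p j) b * b powi e j * b powi x j) \<le> norm (ieval (p j) b * b powi e j) * norm b ^ n"
        by (simp add: norm_mult norm_power_int mult_left_mono)
    qed
    also have "\<dots> = (\<Sum>j\<in>I. norm (ieval (p j) b * b powi e j)) * norm b ^ n"
      by (simp add: sum_distrib_right)
    also have "\<dots> \<le> B * norm b ^ n"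
      unfolding B_def by (intro mult_right_mono sum_mono2) auto
    finally show False using n by simp
  qed
qed

lemma ieval_inverse_eq_0_iff:
  "a \<noteq> 0 \<Longrightarrow> ieval g (inverse a) = 0 \<longleftrightarrow> ieval (reflect_poly g) a = 0"
  using ieval_reflect_poly[of "inverse a" g] by auto

lemma tail_avoiding_or_inverse:
  fixes q :: "'k::finite \<Rightarrow> complex"
  assumes a: "algebraic a" "a \<noteq> 0" "\<not> root_of_unity a" and q: "\<And>j. q j \<in> laurent a"
  shows "tail_avoiding a q \<or> tail_avoiding (inverse a) q"
proof -
  obtain f where f: "irreducible f" "degree f > 0" "ieval f a = 0"
    using algebraic_imp_irreducible a by blast
  have nonzero: "b \<noteq> 0" if "ieval f b = 0" for b
    using that irreducible_coeff_0[OF f(1) f(3) a(2)] ieval_at_0[of f] by auto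
  have conj: "ieval g a = 0 \<longleftrightarrow> ieval g b = 0" if "ieval f b = 0" for g b
    using irreducible_dvd_of_common_root[OF f(1,2)] ieval_dvd[of f g] f(3) that by metis
  \<comment> \<open>If all three cases fail, \<open>f(0)\<close> is a unit and every conjugate has
    norm 1, so Kronecker's theorem makes \<open>a\<close> a root of unity.\<close>
  consider "\<not> is_unit (coeff f 0)" | b where "ieval f b = 0" "norm b < 1"
    | b where "ieval f b = 0" "norm b > 1"
    using kronecker_root_of_unity[OF f] a(3) by (metis linorder_neqE)
  then show ?thesis
  proof cases
    case 1
    then show ?thesis using tail_avoiding_if_nonunit f a q by blast
  next
    case 2
    then have "tail_avoiding a q"
      using a nonzero conj q by (intro tail_avoiding_if_small_conjugate[of a b]) auto
    then show ?thesis ..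
  next
    case 3
    have "tail_avoiding (inverse a) q"
    proof (rule tail_avoiding_if_small_conjugate)
      show "norm (inverse b) < 1" using 3 nonzero by (simp add: norm_inverse inverse_less_1_iff)
      show "ieval g (inverse a) = 0 \<longleftrightarrow> ieval g (inverse b) = 0" for g
        using conj nonzero 3 a by (simp add: ieval_inverse_eq_0_iff)
    qed (use 3 nonzero a q laurent_inverse in auto)
    then show ?thesis ..
  qed
qed

section \<open>Spans of minimal vanishing sets\<close>

text \<open>The abstract predicate \<open>V\<close> covers both clusters of the system and minimal
  vanishing sums of a single equation.\<close>

definition minimal_set :: "('a set \<Rightarrow> bool) \<Rightarrow> 'a set \<Rightarrow> bool" where
  "minimal_set V J \<longleftrightarrow> J \<noteq> {} \<and> V J \<and> (\<forall>I. I \<noteq> {} \<and> I \<subset> J \<longrightarrow> \<not> V I)"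

lemma minimal_set_psubset: "minimal_set V J \<Longrightarrow> I \<noteq> {} \<Longrightarrow> I \<subset> J \<Longrightarrow> \<not> V I"
  by (simp add: minimal_set_def)

text \<open>A nonminimal \<open>J\<close> splits into a smaller set satisfying \<open>V\<close> and
  its complement in \<open>J\<close>, to which induction applies.\<close>

lemma minimal_set_partition:
  assumes "finite J" "V J" and diff: "\<And>I J. V I \<Longrightarrow> V J \<Longrightarrow> I \<subseteq> J \<Longrightarrow> V (J - I)"
  obtains P where "partition_on J P" "\<And>I. I \<in> P \<Longrightarrow> minimal_set V I"
proof -
  have "\<exists>P. partition_on J P \<and> (\<forall>I\<in>P. minimal_set V I)"
    using assms(1,2)
  proof (induction J rule: finite_psubset_induct)
    case (psubset J)
    show ?case
    proof (cases "J = {}")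
      case True
      then show ?thesis by (auto simp: partition_on_def)
    next
      case False
      show ?thesis
      proof (cases "minimal_set V J")
        case True
        then show ?thesis using False by (intro exI[of _ "{J}"]) (auto intro: partition_on_space)
      next
        case nonmin: False
        then obtain I where I: "I \<noteq> {}" "I \<subset> J" "V I"
          using False psubset.prems by (auto simp: minimal_set_def)
        then have "V (J - I)" using diff psubset.prems by blast
        moreover have "J - I \<subset> J" using I by blast
        ultimately obtain P Q where P: "partition_on I P" "\<forall>I\<in>P. minimal_set V I"
          and Q: "partition_on (J - I) Q" "\<forall>I\<in>Q. minimal_set V I"
          using psubset.IH I by metis
        have "partition_on (I \<union> (J - I)) (P \<union> Q)"
          using P(1) Q(1) by (auto simp: partition_on_def intro!: disjoint_union)
        moreover have "I \<union> (J - I) = J" using I by blast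
        ultimately show ?thesis using P(2) Q(2) by auto
      qed
    qed
  qed
  then show ?thesis using that by blast
qed

text \<open>Each widening of the window above the minimum by \<open>G\<close> captures a new element
  until all of \<open>J\<close> is covered. Allowing any \<open>n\<close> at least
  \<open>card J\<close> later gives a bound independent of \<open>J\<close>.\<close>

lemma iterated_growth_bound:
  fixes x :: "'a \<Rightarrow> int" and G :: "int \<Rightarrow> int"
  assumes "finite J" and m: "m \<in> J" "\<And>j. j \<in> J \<Longrightarrow> x m \<le> x j" and G: "\<And>d. d \<le> G d"
    and step: "\<And>d. 0 \<le> d \<Longrightarrow> {j \<in> J. x j \<le> x m + d} \<noteq> J \<Longrightarrow>
      \<exists>j\<in>J. x m + d < x j \<and> x j \<le> x m + G d"
    and "j \<in> J" "card J \<le> n"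
  shows "x j \<le> x m + (G ^^ n) 0"
proof -
  let ?A = "\<lambda>r. {j \<in> J. x j \<le> x m + (G ^^ r) 0}"
  have nonneg: "0 \<le> (G ^^ r) 0" for r
    by (induction r) (auto intro: order_trans G)
  have "?A r = J \<or> r < card (?A r)" for r
  proof (induction r)
    case 0
    have "m \<in> ?A 0" using m by simp
    then have "0 < card (?A 0)" using assms(1) by (subst card_gt_0_iff) auto
    then show ?case by blast
  next
    case (Suc r)
    have sub: "?A r \<subseteq> ?A (Suc r)" using G[of "(G ^^ r) 0"] by auto
    show ?case
    proof (cases "?A r = J")
      case True
      then show ?thesis using sub by blast
    next
      case False
      then obtain j where "j \<in> J" "x m + (G ^^ r) 0 < x j" "x j \<le> x m + (G ^^ Suc r) 0"
        using step[OF nonneg] by auto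
      then have "?A r \<subset> ?A (Suc r)" using sub by force
      then have "card (?A r) < card (?A (Suc r))" using assms(1) by (intro psubset_card_mono) auto
      then show ?thesis using Suc False by auto
    qed
  qed
  moreover have "card (?A n) \<le> card J" using assms(1) by (intro card_mono) auto
  ultimately have "?A n = J" using \<open>card J \<le> n\<close> by force
  then show ?thesis using \<open>j \<in> J\<close> by blast
qed

text \<open>Relative to the minimal exponent, the lower part of \<open>J\<close> has only finitely
  many possible sums, all nonzero by minimality. The upper part must cancel such a sum, so it cannot
  start too far away.\<close>

lemma minimal_set_span_bounded_of_tail_avoiding:
  fixes q :: "'k::finite \<Rightarrow> complex"
  assumes a: "a \<noteq> 0" and q: "\<And>j. q j \<in> laurent a" and tail: "tail_avoiding a q"
  shows "\<exists>D. \<forall>x J. minimal_set (\<lambda>I. (\<Sum>j\<in>I. q j * a powi x j) = 0) J \<longrightarrow>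
    (\<forall>j\<in>J. \<forall>l\<in>J. x j \<le> x l + D)"
proof -
  let ?C = "\<lambda>d. (\<lambda>(A, e). - (\<Sum>j\<in>A. q j * a powi e j)) ` (UNIV \<times> (\<Pi>\<^sub>E j\<in>UNIV. {0..d :: int}))"
  have fin: "finite (?C d)" for d
    by (intro finite_imageI finite_cartesian_product finite_PiE) auto
  have lau: "c \<in> laurent a" if "c \<in> ?C d" for c d
    using that a q by (auto intro!: laurent_uminus laurent_sum laurent_power_int_mult)
  have "\<forall>c\<in>laurent a - {0}. \<exists>N. \<forall>I x. (\<forall>j\<in>I. N \<le> x j) \<longrightarrow> (\<Sum>j\<in>I. q j * a powi x j) \<noteq> c"
    using tail by (simp add: tail_avoiding_def)
  then obtain N where N: "\<And>c I x. c \<in> laurent a - {0} \<Longrightarrow> (\<forall>j\<in>I. N c \<le> x j) \<Longrightarrow>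
      (\<Sum>j\<in>I. q j * a powi x j) \<noteq> c"
    by metis
  \<comment> \<open>Inserting \<open>d\<close> ensures \<open>d \<le> G d\<close>.\<close>
  define G where "G d = Max (insert d (N ` ?C d))" for d
  have G: "d \<le> G d" "c \<in> ?C d \<Longrightarrow> N c \<le> G d" for c d
    using fin[of d] unfolding G_def by (auto intro!: Max_ge)
  have "x j \<le> x l + (G ^^ CARD('k)) 0"
    if min: "minimal_set (\<lambda>I. (\<Sum>j\<in>I. q j * a powi x j) = 0) J" and jl: "j \<in> J" "l \<in> J" for x J j l
  proof -
    obtain m where "is_arg_min x (\<lambda>j. j \<in> J) m"
      using ex_is_arg_min_if_finite[of J x] jl by auto
    then have m: "m \<in> J" "\<And>j. j \<in> J \<Longrightarrow> x m \<le> x j"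
      by (auto simp: is_arg_min_linorder)
    have "x j \<le> x m + (G ^^ CARD('k)) 0"
    proof (rule iterated_growth_bound[of J m x G])
      fix d :: int
      let ?A = "{j \<in> J. x j \<le> x m + d}"
      assume d: "0 \<le> d" "?A \<noteq> J"
      show "\<exists>j\<in>J. x m + d < x j \<and> x j \<le> x m + G d"
      proof (rule ccontr)
        assume gap: "\<not> ?thesis"
        have "m \<in> ?A" using m d by simp
        then have "?A \<noteq> {}" by blast
        moreover have "?A \<subset> J" using d by blast
        ultimately have ne: "(\<Sum>j\<in>?A. q j * a powi x j) \<noteq> 0"
          by (rule minimal_set_psubset[OF min])
        define c where "c = - (\<Sum>j\<in>?A. q j * a powi (x j - x m))"
        have shift: "(\<Sum>j\<in>I. q j * a powi (x j - x m)) = (\<Sum>j\<in>I. q j * a powi x j) / a powi x m" for I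
          using a by (simp add: power_int_diff sum_divide_distrib)
        have "c \<noteq> 0" using ne a unfolding c_def shift by simp
        \<comment> \<open>Exponents outside \<open>?A\<close> do not affect the sum; setting them to
          0 places the exponent function in the finite set defining \<open>?C d\<close>.\<close>
        have "c = - (\<Sum>j\<in>?A. q j * a powi (if j \<in> ?A then x j - x m else 0))"
          unfolding c_def by (intro arg_cong[of _ _ uminus] sum.cong) auto
        moreover have "(\<lambda>j. if j \<in> ?A then x j - x m else 0) \<in> (\<Pi>\<^sub>E j\<in>UNIV. {0..d})"
          using m d(1) by auto
        ultimately have c: "c \<in> ?C d"
          by (intro image_eqI[of _ _ "(?A, \<lambda>j. if j \<in> ?A then x j - x m else 0)"]) auto
        have "(\<Sum>j\<in>J. q j * a powi x j) = 0" using min by (simp add: minimal_set_def)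
        moreover have "(\<Sum>j\<in>J. q j * a powi x j) =
            (\<Sum>j\<in>J - ?A. q j * a powi x j) + (\<Sum>j\<in>?A. q j * a powi x j)"
          by (rule sum.subset_diff) auto
        ultimately have "(\<Sum>j\<in>J - ?A. q j * a powi (x j - x m)) = c"
          unfolding c_def shift by (simp add: add_eq_0_iff)
        moreover have "\<forall>j\<in>J - ?A. N c \<le> x j - x m"
        proof
          fix j assume "j \<in> J - ?A"
          then have "\<not> x j \<le> x m + G d" using gap by auto
          then show "N c \<le> x j - x m" using G(2)[OF c] by linarith
        qed
        moreover have "c \<in> laurent a - {0}" using lau[OF c] \<open>c \<noteq> 0\<close> by blast
        ultimately show False using N[of c "J - ?A" "\<lambda>j. x j - x m"] by blast
      qed
    qed (use m G jl in \<open>auto intro: card_mono\<close>)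
    then show ?thesis using m(2)[OF jl(2)] by linarith
  qed
  then show ?thesis by blast
qed

text \<open>If only the inverse of \<open>a\<close> avoids tails, negating all exponents rewrites
  the sums in terms of the inverse and merely reverses the order of the exponents.\<close>

lemma minimal_set_span_bounded:
  fixes q :: "'k::finite \<Rightarrow> complex"
  assumes a: "algebraic a" "a \<noteq> 0" "\<not> root_of_unity a" and q: "\<And>j. q j \<in> laurent a"
  shows "\<exists>D. \<forall>x J. minimal_set (\<lambda>I. (\<Sum>j\<in>I. q j * a powi x j) = 0) J \<longrightarrow>
    (\<forall>j\<in>J. \<forall>l\<in>J. x j \<le> x l + D)"
proof (cases "tail_avoiding a q")
  case True
  then show ?thesis using minimal_set_span_bounded_of_tail_avoiding a q by blast
next
  case False
  then have "tail_avoiding (inverse a) q" using tail_avoiding_or_inverse a q by blast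
  moreover have "inverse a \<noteq> 0" "\<And>j. q j \<in> laurent (inverse a)"
    using a q laurent_inverse by simp_all
  ultimately obtain D where D: "\<And>x J j l.
      minimal_set (\<lambda>I. (\<Sum>j\<in>I. q j * inverse a powi x j) = 0) J \<Longrightarrow>
      j \<in> J \<Longrightarrow> l \<in> J \<Longrightarrow> x j \<le> x l + D"
    using minimal_set_span_bounded_of_tail_avoiding[of "inverse a" q] by meson
  have inv: "inverse a powi (- n) = a powi n" for n
    by (simp add: power_int_inverse power_int_minus)
  show ?thesis
  proof (intro exI[of _ D] allI impI ballI)
    fix x J j l
    assume "minimal_set (\<lambda>I. (\<Sum>j\<in>I. q j * a powi x j) = 0) J" "j \<in> J" "l \<in> J"
    then have "- x l \<le> - x j + D" using D[of "\<lambda>j. - x j" J l j] by (simp add: inv)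
    then show "x j \<le> x l + D" by simp
  qed
qed

lemma minimal_system_span_bounded:
  fixes q :: "nat \<Rightarrow> 'k::finite \<Rightarrow> complex"
  assumes a: "\<And>i. i \<in> {1..t} \<Longrightarrow> algebraic (\<alpha> i) \<and> \<alpha> i \<noteq> 0 \<and> \<not> root_of_unity (\<alpha> i)"
    and q: "\<And>i j. i \<in> {1..t} \<Longrightarrow> q i j \<in> laurent (\<alpha> i)"
  shows "\<exists>D. \<forall>x J. minimal_set (vanishes_on \<alpha> q t x) J \<longrightarrow>
    (\<forall>j\<in>J. \<forall>l\<in>J. x $ j \<le> x $ l + D)"
proof -
  let ?V = "\<lambda>i x I. (\<Sum>j\<in>I. q i j * \<alpha> i powi (x $ j)) = 0"
  have "\<forall>i\<in>{1..t}. \<exists>D. \<forall>x J. minimal_set (?V i x) J \<longrightarrow> (\<forall>j\<in>J. \<forall>l\<in>J. x $ j \<le> x $ l + D)"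
  proof
    fix i assume i: "i \<in> {1..t}"
    then obtain D where "\<forall>x J. minimal_set (\<lambda>I. (\<Sum>j\<in>I. q i j * \<alpha> i powi x j) = 0) J \<longrightarrow>
        (\<forall>j\<in>J. \<forall>l\<in>J. x j \<le> x l + D)"
      using minimal_set_span_bounded[of "\<alpha> i" "q i"] a q by blast
    then have "\<forall>x J. minimal_set (?V i x) J \<longrightarrow> (\<forall>j\<in>J. \<forall>l\<in>J. x $ j \<le> x $ l + D)" by simp
    then show "\<exists>D. \<forall>x J. minimal_set (?V i x) J \<longrightarrow> (\<forall>j\<in>J. \<forall>l\<in>J. x $ j \<le> x $ l + D)" by blast
  qed
  then obtain D' where D': "\<And>i x J j l. i \<in> {1..t} \<Longrightarrow> minimal_set (?V i x) J \<Longrightarrow>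
      j \<in> J \<Longrightarrow> l \<in> J \<Longrightarrow> x $ j \<le> x $ l + D' i"
    by metis
  \<comment> \<open>A common bound for all equations, equal to 0 when \<open>t = 0\<close>.\<close>
  define D where "D = (\<Sum>i=1..t. \<bar>D' i\<bar>)"
  have D: "D' i \<le> D" if "i \<in> {1..t}" for i
    using member_le_sum[of i "{1..t}" "\<lambda>i. \<bar>D' i\<bar>"] that by (simp add: D_def)
  define G where "G d = d + D" for d
  have "D \<ge> 0" unfolding D_def by (intro sum_nonneg) auto
  have "x $ j \<le> x $ l + (G ^^ CARD('k)) 0"
    if min: "minimal_set (vanishes_on \<alpha> q t x) J" and jl: "j \<in> J" "l \<in> J" for x J j l
  proof -
    obtain m where "is_arg_min (($) x) (\<lambda>j. j \<in> J) m"
      using ex_is_arg_min_if_finite[of J "($) x"] jl by auto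
    then have m: "m \<in> J" "\<And>j. j \<in> J \<Longrightarrow> x $ m \<le> x $ j"
      by (auto simp: is_arg_min_linorder)
    have "x $ j \<le> x $ m + (G ^^ CARD('k)) 0"
    proof (rule iterated_growth_bound[of J m "($) x" G])
      fix d :: int
      let ?A = "{j \<in> J. x $ j \<le> x $ m + d}"
      assume d: "0 \<le> d" "?A \<noteq> J"
      show "\<exists>j\<in>J. x $ m + d < x $ j \<and> x $ j \<le> x $ m + G d"
      proof (rule ccontr)
        assume gap: "\<not> ?thesis"
        have "?V i x ?A" if i: "i \<in> {1..t}" for i
        proof -
          have "?V i x J" using min i by (auto simp: minimal_set_def vanishes_on_def)
          moreover have "?V i x (J - I)" if "?V i x I" "?V i x J" "I \<subseteq> J" for I J
            using that by (simp add: sum_diff)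
          ultimately obtain P where P: "partition_on J P" "\<And>I. I \<in> P \<Longrightarrow> minimal_set (?V i x) I"
            using minimal_set_partition[of J "?V i x"] by auto
          \<comment> \<open>A block of the \<open>i\<close>-th equation has span at most
            \<open>D\<close>, so it cannot jump over the gap. Hence \<open>?A\<close> is a union of
            vanishing blocks.\<close>
          have "I \<subseteq> ?A" if I: "I \<in> P" "k \<in> I" "k \<in> ?A" for I k
          proof
            fix k' assume k': "k' \<in> I"
            then have "x $ k' \<le> x $ k + D' i" "k' \<in> J"
              using D'[OF i P(2)] I P(1) by (auto simp: partition_on_def)
            then show "k' \<in> ?A" using D[OF i] I gap by (force simp: G_def)
          qed
          then have A: "?A = \<Union>{I \<in> P. I \<subseteq> ?A}"
            using P(1) unfolding partition_on_def by blast
          have "(\<Sum>j\<in>\<Union>{I \<in> P. I \<subseteq> ?A}. q i j * \<alpha> i powi (x $ j)) =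
              (\<Sum>I | I \<in> P \<and> I \<subseteq> ?A. \<Sum>j\<in>I. q i j * \<alpha> i powi (x $ j))"
            using P(1) by (subst sum.Union_disjoint) (auto simp: partition_on_def disjoint_def)
          also have "\<dots> = 0" using P(2) by (intro sum.neutral) (auto simp: minimal_set_def)
          finally show ?thesis using A by simp
        qed
        then have "vanishes_on \<alpha> q t x ?A" by (simp add: vanishes_on_def)
        moreover have "m \<in> ?A" using m d by simp
        then have "?A \<noteq> {}" by blast
        moreover have "?A \<subset> J" using d by blast
        ultimately show False using minimal_set_psubset[OF min] by metis
      qed
    qed (use m jl \<open>D \<ge> 0\<close> in \<open>auto simp: G_def intro: card_mono\<close>)
    then show ?thesis using m(2)[OF jl(2)] by linarith
  qed
  then show ?thesis by blast
qed

section \<open>Clusters and their translates\<close>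

lemma is_cluster_iff_minimal: "is_cluster \<alpha> q t x J \<longleftrightarrow> minimal_set (vanishes_on \<alpha> q t x) J"
  by (simp add: is_cluster_def minimal_set_def)

lemma diff_le_cluster_span:
  assumes "j \<in> J" "l \<in> J"
  shows "x $ j - x $ l \<le> cluster_span x J"
proof -
  have "x $ j \<le> Max (($) x ` J)" "Min (($) x ` J) \<le> x $ l"
    using assms by (auto intro: Max_ge Min_le)
  then show ?thesis by (simp add: cluster_span_def)
qed

lemma cluster_span_leI:
  assumes "J \<noteq> {}" "\<And>j l. j \<in> J \<Longrightarrow> l \<in> J \<Longrightarrow> x $ j \<le> x $ l + D"
  shows "cluster_span x J \<le> D"
proof -
  have "Max (($) x ` J) \<in> ($) x ` J" "Min (($) x ` J) \<in> ($) x ` J"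
    using assms by (auto intro: Max_in Min_in)
  then show ?thesis using assms(2) by (force simp: cluster_span_def)
qed

text \<open>A common shift multiplies each sum by a nonzero power of its base.\<close>

lemma vanishes_on_translate:
  assumes "\<And>i. i \<in> {1..t} \<Longrightarrow> \<alpha> i \<noteq> 0" "\<And>j. j \<in> J \<Longrightarrow> y $ j = x $ j + c"
  shows "vanishes_on \<alpha> q t y J \<longleftrightarrow> vanishes_on \<alpha> q t x J"
proof -
  have "(\<Sum>j\<in>J. q i j * \<alpha> i powi (y $ j)) = (\<Sum>j\<in>J. q i j * \<alpha> i powi (x $ j)) * \<alpha> i powi c"
    if "i \<in> {1..t}" for i
    unfolding sum_distrib_right using that assms by (intro sum.cong) (auto simp: power_int_add)
  then show ?thesis using assms(1) by (auto simp: vanishes_on_def)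
qed

lemma is_cluster_translate:
  assumes "\<And>i. i \<in> {1..t} \<Longrightarrow> \<alpha> i \<noteq> 0" "\<And>j. j \<in> J \<Longrightarrow> y $ j = x $ j + c"
  shows "is_cluster \<alpha> q t y J \<longleftrightarrow> is_cluster \<alpha> q t x J"
proof -
  have "vanishes_on \<alpha> q t y I \<longleftrightarrow> vanishes_on \<alpha> q t x I" if "I \<subseteq> J" for I
    using that assms by (intro vanishes_on_translate) auto
  then show ?thesis unfolding is_cluster_def by blast
qed

section \<open>The common period of the roots of unity and translation of solutions\<close>

lemma power_N_E_eq_1:
  assumes "i \<in> {t+1..s}" "root_of_unity (\<alpha> i)"
  shows "\<alpha> i ^ N_E \<alpha> t s = 1"
proof -
  have "\<exists>n. n > 0 \<and> \<alpha> i ^ n = 1" using assms by (simp add: root_of_unity_def)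
  then have "\<alpha> i ^ mult_order (\<alpha> i) = 1" unfolding mult_order_def by (metis (mono_tags, lifting) LeastI)
  moreover have "mult_order (\<alpha> i) dvd N_E \<alpha> t s" using assms by (auto simp: N_E_def)
  ultimately show ?thesis by (auto simp: power_mult elim!: dvdE)
qed

lemma N_E_pos:
  assumes "\<And>i. i \<in> {t+1..s} \<Longrightarrow> root_of_unity (\<alpha> i)"
  shows "N_E \<alpha> t s > 0"
proof -
  have "mult_order (\<alpha> i) \<noteq> 0" if "i \<in> {t+1..s}" for i
  proof -
    have "\<exists>n. n > 0 \<and> \<alpha> i ^ n = 1" using assms that by (simp add: root_of_unity_def)
    then show ?thesis unfolding mult_order_def by (metis (mono_tags, lifting) LeastI less_irrefl)
  qed
  then have "0 \<notin> (\<lambda>i. mult_order (\<alpha> i)) ` {t+1..s}" by force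
  then have "Lcm ((\<lambda>i. mult_order (\<alpha> i)) ` {t+1..s}) \<noteq> 0"
    by (subst Lcm_0_iff) auto
  then show ?thesis
    unfolding N_E_def by (cases "t = s") (simp_all only: simp_thms if_True if_False zero_less_one neq0_conv)
qed

lemma sum_indicator_vec_nth:
  assumes "partition_on UNIV P" "J \<in> P" "j \<in> J"
  shows "(\<Sum>K\<in>P. b K *s indicator_vec K) $ j = (b J :: int)"
proof -
  have "(\<Sum>K\<in>P. b K *s indicator_vec K) $ j = (\<Sum>K\<in>P. if K = J then b K else 0)"
    unfolding sum_component using assms
    by (intro sum.cong) (auto simp: indicator_vec_def partition_on_def disjoint_def)
  then show ?thesis using assms by (simp add: finite_subset[OF subset_UNIV])
qed

text \<open>For the first \<open>t\<close> equations every cluster still sums to 0 after its own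
  shift; for the others the shift is a multiple of the order of the base and changes no
  term.\<close>

lemma translate_solution:
  fixes x y :: "int ^ 'k::finite"
  assumes \<alpha>: "\<And>i. i \<in> {1..t} \<Longrightarrow> \<alpha> i \<noteq> 0" and rou: "\<And>i. i \<in> {t+1..s} \<Longrightarrow> root_of_unity (\<alpha> i)"
    and x: "x \<in> solutions \<alpha> q s" and P: "cluster_structure \<alpha> q t x P"
    and y: "\<And>J j. J \<in> P \<Longrightarrow> j \<in> J \<Longrightarrow> y $ j = x $ j + int (N_E \<alpha> t s) * \<beta> J"
  shows "y \<in> solutions \<alpha> q s" "cluster_structure \<alpha> q t y P"
proof -
  have part: "partition_on UNIV P" using P by (simp add: cluster_structure_def)
  have clus: "is_cluster \<alpha> q t y J" if "J \<in> P" for J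
    using that P y \<alpha> is_cluster_translate[of t \<alpha> J y x] by (simp add: cluster_structure_def)
  then show "cluster_structure \<alpha> q t y P" using part by (simp add: cluster_structure_def)
  have "(\<Sum>j\<in>UNIV. q i j * \<alpha> i powi (y $ j)) = 0" if i: "i \<in> {1..s}" for i
  proof (cases "i \<le> t")
    case True
    have "(\<Sum>j\<in>\<Union>P. q i j * \<alpha> i powi (y $ j)) = (\<Sum>J\<in>P. \<Sum>j\<in>J. q i j * \<alpha> i powi (y $ j))"
      using part by (subst sum.Union_disjoint) (auto simp: partition_on_def disjoint_def)
    also have "\<dots> = 0"
      using clus i True by (intro sum.neutral) (auto simp: is_cluster_def vanishes_on_def)
    finally show ?thesis using part by (simp add: partition_on_def)
  next
    case False
    then have one: "\<alpha> i ^ N_E \<alpha> t s = 1" using power_N_E_eq_1 rou i by simp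
    moreover have "N_E \<alpha> t s > 0" using N_E_pos[of t s \<alpha>] rou by blast
    ultimately have ne: "\<alpha> i \<noteq> 0" by (auto simp: zero_power)
    have "\<alpha> i powi (y $ j) = \<alpha> i powi (x $ j)" for j
    proof -
      obtain J where J: "J \<in> P" "j \<in> J" using partition_onD1[OF part] by blast
      show ?thesis using y[OF J] ne one by (simp add: power_int_add power_int_mult)
    qed
    then show ?thesis using x i by (simp add: solutions_def)
  qed
  then show "y \<in> solutions \<alpha> q s" by (simp add: solutions_def)
qed

text \<open>This finiteness makes \<open>maxspan\<close>, defined by \<open>Max\<close>, an actual
  upper bound for the spans.\<close>

lemma finite_cluster_spans:
  fixes q :: "nat \<Rightarrow> 'k::finite \<Rightarrow> complex"
  assumes a: "\<And>i. i \<in> {1..t} \<Longrightarrow> algebraic (\<alpha> i) \<and> \<alpha> i \<noteq> 0 \<and> \<not> root_of_unity (\<alpha> i)"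
    and q: "\<And>i j. i \<in> {1..t} \<Longrightarrow> q i j \<in> laurent (\<alpha> i)"
  shows "finite {cluster_span x J | x J. x \<in> solutions \<alpha> q t \<and> is_cluster \<alpha> q t x J}"
proof -
  obtain D where D: "\<And>x J j l. minimal_set (vanishes_on \<alpha> q t x) J \<Longrightarrow> j \<in> J \<Longrightarrow> l \<in> J \<Longrightarrow>
      x $ j \<le> x $ l + D"
    using minimal_system_span_bounded a q by metis
  have "{cluster_span x J | x J. x \<in> solutions \<alpha> q t \<and> is_cluster \<alpha> q t x J} \<subseteq> {0..D}"
  proof clarify
    fix x J assume "is_cluster \<alpha> q t x J"
    then have J: "minimal_set (vanishes_on \<alpha> q t x) J" "J \<noteq> {}"
      by (simp_all add: is_cluster_iff_minimal minimal_set_def)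
    then obtain j where "j \<in> J" by blast
    then have "0 \<le> cluster_span x J" using diff_le_cluster_span[of j J j x] by simp
    moreover have "cluster_span x J \<le> D" using J D by (intro cluster_span_leI) blast+
    ultimately show "cluster_span x J \<in> {0..D}" by simp
  qed
  then show ?thesis using finite_subset by blast
qed

lemma solutions_antimono: "t \<le> s \<Longrightarrow> solutions \<alpha> q s \<subseteq> solutions \<alpha> q t"
  by (auto simp: solutions_def)

lemma cluster_structure_exists:
  assumes "x \<in> solutions \<alpha> q t"
  obtains P where "cluster_structure \<alpha> q t x P"
proof -
  have "vanishes_on \<alpha> q t x UNIV" using assms by (simp add: solutions_def vanishes_on_def)
  moreover have "vanishes_on \<alpha> q t x (J - I)"
    if "vanishes_on \<alpha> q t x I" "vanishes_on \<alpha> q t x J" "I \<subseteq> J" for I J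
    using that by (simp add: vanishes_on_def sum_diff)
  ultimately obtain P where "partition_on UNIV P" "\<And>I. I \<in> P \<Longrightarrow> minimal_set (vanishes_on \<alpha> q t x) I"
    using minimal_set_partition[of UNIV "vanishes_on \<alpha> q t x"] by (metis finite)
  then show ?thesis by (intro that[of P]) (simp add: cluster_structure_def is_cluster_iff_minimal)
qed

section \<open>The finite box and the decomposition of the solution set\<close>

lemma finite_bounded_int_vectors: "finite {x :: int ^ 'k::finite. \<forall>j. 0 \<le> x $ j \<and> x $ j < B}"
proof (rule finite_subset)
  show "{x :: int ^ 'k. \<forall>j. 0 \<le> x $ j \<and> x $ j < B} \<subseteq> vec_lambda ` (\<Pi>\<^sub>E j\<in>UNIV. {0..<B})"
  proof
    fix x :: "int ^ 'k" assume "x \<in> {x. \<forall>j. 0 \<le> x $ j \<and> x $ j < B}"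
    then show "x \<in> vec_lambda ` (\<Pi>\<^sub>E j\<in>UNIV. {0..<B})"
      by (intro image_eqI[of _ _ "($) x"]) auto
  qed
qed (intro finite_imageI finite_PiE; simp)

theorem proposition6p1:
  fixes \<alpha> :: "nat \<Rightarrow> complex" and q :: "nat \<Rightarrow> 'k::finite \<Rightarrow> complex" and s t :: nat
  assumes "t \<le> s"
    and "\<And>i. i \<in> {1..t} \<Longrightarrow> algebraic (\<alpha> i) \<and> \<alpha> i \<noteq> 0 \<and> \<not> root_of_unity (\<alpha> i)"
    and "\<And>i. i \<in> {t+1..s} \<Longrightarrow> root_of_unity (\<alpha> i) \<and> \<alpha> i \<noteq> 1"
    and "\<And>i j. i \<in> {1..s} \<Longrightarrow> q i j \<in> int_adjoin (\<alpha> i)"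
    and "\<And>j. \<exists>i\<in>{1..s}. q i j \<noteq> 0"
  shows "finite (T_set \<alpha> q t s) \<and>
         solutions \<alpha> q s = (\<Union>(x, P)\<in>T_set \<alpha> q t s. S_set \<alpha> t s x P)"
proof (intro conjI equalityI subsetI)
  have "T_set \<alpha> q t s \<subseteq> {x. \<forall>j. 0 \<le> x $ j \<and> x $ j < int (N_E \<alpha> t s) + maxspan \<alpha> q t} \<times> UNIV"
    by (auto simp: T_set_def)
  then show "finite (T_set \<alpha> q t s)"
    by (rule finite_subset) (intro finite_cartesian_product finite_bounded_int_vectors finite)
next
  fix y assume "y \<in> (\<Union>(x, P)\<in>T_set \<alpha> q t s. S_set \<alpha> t s x P)"
  then obtain x P \<beta> where x: "x \<in> solutions \<alpha> q s" and P: "cluster_structure \<alpha> q t x P"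
    and y: "y = x + (\<Sum>J\<in>P. (int (N_E \<alpha> t s) * \<beta> J) *s indicator_vec J)"
    by (auto simp: T_set_def S_set_def)
  have "y $ j = x $ j + int (N_E \<alpha> t s) * \<beta> J" if "J \<in> P" "j \<in> J" for J j
    using P that sum_indicator_vec_nth[of P J j "\<lambda>J. int (N_E \<alpha> t s) * \<beta> J"]
    unfolding y cluster_structure_def vector_add_component by simp
  then show "y \<in> solutions \<alpha> q s"
    using translate_solution(1)[OF _ _ x P] assms by blast
next
  fix y assume y: "y \<in> solutions \<alpha> q s"
  define N where "N = int (N_E \<alpha> t s)"
  have N: "N > 0" using N_E_pos assms(3) by (simp add: N_def)
  have laurent: "q i j \<in> laurent (\<alpha> i)" if "i \<in> {1..t}" for i j
  proof -
    have "q i j \<in> int_adjoin (\<alpha> i)" using that assms by auto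
    then obtain p where "q i j = ieval p (\<alpha> i) * \<alpha> i powi 0" by (auto simp: int_adjoin_def ieval_def)
    then show ?thesis unfolding laurent_def by blast
  qed
  obtain P where P: "cluster_structure \<alpha> q t y P"
    by (rule cluster_structure_exists[OF subsetD[OF solutions_antimono[OF assms(1)] y]])
  then have part: "partition_on UNIV P" by (simp add: cluster_structure_def)
  \<comment> \<open>The quotient by \<open>N\<close> of the least exponent in \<open>J\<close>:
    subtracting \<open>N * \<beta> J\<close> leaves its remainder as the new minimum of the
    cluster.\<close>
  define \<beta> where "\<beta> J = Min (($) y ` J) div N" for J
  define x where "x = y - (\<Sum>J\<in>P. (N * \<beta> J) *s indicator_vec J)"
  have xj: "x $ j = y $ j + N * - \<beta> J" if "J \<in> P" "j \<in> J" for J j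
    using sum_indicator_vec_nth[OF part that, of "\<lambda>J. N * \<beta> J"]
    unfolding x_def vector_minus_component by simp
  have x: "x \<in> solutions \<alpha> q s" "cluster_structure \<alpha> q t x P"
    using assms(2,3) xj unfolding N_def
    by (intro translate_solution[OF _ _ y P, of x "\<lambda>J. - \<beta> J"]; blast)+
  have "0 \<le> x $ j \<and> x $ j < N + maxspan \<alpha> q t" for j
  proof -
    obtain J where J: "J \<in> P" "j \<in> J" using partition_onD1[OF part] by blast
    have "Min (($) y ` J) \<in> ($) y ` J" using J by (intro Min_in) auto
    then obtain l where l: "l \<in> J" "Min (($) y ` J) = y $ l" by auto
    have "y $ l \<le> y $ j" using J l by (metis Min_le finite finite_imageI image_eqI)
    moreover have "x $ l = y $ l mod N"
      using xj[OF J(1) l(1)] l(2) by (simp add: \<beta>_def minus_mult_div_eq_mod)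
    moreover have "0 \<le> y $ l mod N" "y $ l mod N < N" using N by simp_all
    \<comment> \<open>The minimum \<open>x $ l\<close> is below \<open>N\<close>, so bounding the
      distance to it by the span puts the whole cluster in the box.\<close>
    moreover have "x $ j - x $ l \<le> maxspan \<alpha> q t"
    proof -
      have "finite {cluster_span x J | x J. x \<in> solutions \<alpha> q t \<and> is_cluster \<alpha> q t x J}"
        by (rule finite_cluster_spans) (use assms(2) laurent in auto)
      moreover have "x \<in> solutions \<alpha> q t"
        using x(1) solutions_antimono[OF \<open>t \<le> s\<close>] by blast
      moreover have "is_cluster \<alpha> q t x J" using x(2) J by (simp add: cluster_structure_def)
      ultimately have "cluster_span x J \<le> maxspan \<alpha> q t"
        unfolding maxspan_def by (intro Max_ge) auto
      then show ?thesis using diff_le_cluster_span[OF J(2) l(1), of x] by linarith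
    qed
    ultimately show ?thesis using xj[OF J] xj[OF J(1) l(1)] by linarith
  qed
  then have "(x, P) \<in> T_set \<alpha> q t s" using x by (simp add: T_set_def N_def)
  moreover have "y \<in> S_set \<alpha> t s x P"
    unfolding S_set_def x_def N_def by (auto intro!: exI[of _ \<beta>])
  ultimately show "y \<in> (\<Union>(x, P)\<in>T_set \<alpha> q t s. S_set \<alpha> t s x P)" by blast
qed

end
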